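(* Let $\mathcal T$ be a weighted naturally oriented tree. Then its edge ideal $I(\mathcal T)$ is bridge-friendly.
   Context: A weighted oriented graph is a triple $\mathcal D=(V,E,\mathbf w)$ with $V$ a finite vertex set, $E$ a set of directed edges whose underlying undirected graph is simple (no loops, no multiple edges), and $\mathbf w:V\to\mathbb N^+$ a weight function. Over a field $\Bbbk$, with $R=\Bbbk[V]$, its edge ideal is $I(\mathcal D)=(xy^{\mathbf w(y)}\mid (x,y)\in E)\subseteq R$, where $(x,y)$ is the edge oriented from $x$ to $y$. A weighted naturally oriented tree is a weighted oriented graph $\mathcal T$ whose underlying graph is a tree with a root vertex $x_0$, such that each edge is oriented towards its endpoint that is further away from $x_0$. Bridge-friendliness. For a monomial ideal $I$ with minimal monomial generating set $\mathcal G(I)$ and a total ordering $>_I$ on $\mathcal G(I)$: $m\in\mathcal G(I)$ is a bridge of $\sigma\subseteq\mathcal G(I)$ if $m\in\sigma$ and $\operatorname{lcm}(\sigma\setminus m)=\operatorname{lcm}(\sigma)$; $\operatorname{sb}(\sigma)$ is the $>_I$-smallest bridge of $\sigma$ if one exists, and $\emptyset$ otherwise ($\sigma\setminus\emptyset=\sigma$). Barile-Macchia algorithm: start with $A=\emptyset$, $\Omega=\{\sigma\subseteq\mathcal G(I):|\sigma|\ge3\}$. (1) Pick $\sigma\in\Omega$ of maximal cardinality. (2) Replace $\Omega$ by $\Omega\setminus\{\sigma,\sigma\setminus\operatorname{sb}(\sigma)\}$; if $\operatorname{sb}(\sigma)\neq\emptyset$ add the directed edge $(\sigma,\sigma\setminus\operatorname{sb}(\sigma))$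 to $A$; if $\Omega\ne\emptyset$ return to (1). (3) Whenever two distinct edges $(\sigma,\sigma\setminus\operatorname{sb}(\sigma))$, $(\sigma',\sigma'\setminus\operatorname{sb}(\sigma'))$ of $A$ have the same target, remove the one whose smallest bridge is larger with respect to $>_I$. A subset $\sigma$ is potentially-type-2 if the edge $(\sigma,\sigma\setminus\operatorname{sb}(\sigma))$ is added to $A$ in step (2); it is type-2 if this edge remains in the final $A$. $I$ is bridge-friendly if there exists a total ordering $>_I$ on $\mathcal G(I)$ such that all potentially-type-2 subsets of $\mathcal G(I)$ are type-2. *)

theory Defs
  imports
    "Graph_Theory.Graph_Theory"
    "HOL-Library.Multiset"
    "HOL-Library.Poly_Mapping"
    "HOL-Algebra.Ideal"
begin

section \<open>Weighted oriented graphs and weighted naturally oriented trees\<close>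

text \<open>
  A \<^locale>\<open>pair_digraph\<close> is finite and has no loops, and its arcs are a set of pairs. Hence the
  underlying undirected graph is simple once antiparallel pairs of arcs are excluded.
  Only the weights of vertices matter, so \<open>w\<close> is unconstrained outside the vertex set.
\<close>

locale weighted_oriented_graph = pair_digraph D
  for D :: "'v pair_pre_digraph" +
  fixes w :: "'v \<Rightarrow> nat"
  assumes no_antiparallel_arcs: "(x, y) \<in> parcs D \<Longrightarrow> (y, x) \<notin> parcs D"
    and weight_pos: "x \<in> pverts D \<Longrightarrow> 0 < w x"

text \<open>
  The underlying undirected graph is represented by its symmetric digraph. There, going back and
  forth along one edge counts as a \<open>cycle\<close> in the sense of the graph library; the cycles of the
  undirected graph are exactly those of length at least three. The library's \<open>tree\<close> is not
  used because on \<open>D\<close> it forbids only directed cycles and on the symmetric digraph it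
  forbids every edge. The library's \<open>connected\<close> refers to the underlying undirected graph
  and includes that there is a vertex.
\<close>

definition underlying_graph :: "'v pair_pre_digraph \<Rightarrow> ('v, 'v \<times> 'v) pre_digraph" where
  "underlying_graph D = with_proj (mk_symmetric (with_proj D))"

definition underlying_tree :: "'v pair_pre_digraph \<Rightarrow> bool" where
  "underlying_tree D \<longleftrightarrow>
     connected (with_proj D) \<and>
     \<not> (\<exists>p. pre_digraph.cycle (underlying_graph D) p \<and> 3 \<le> length p)"

definition underlying_dist :: "'v pair_pre_digraph \<Rightarrow> 'v \<Rightarrow> 'v \<Rightarrow> ereal" where
  "underlying_dist D = wf_digraph.\<mu> (underlying_graph D) (\<lambda>_. 1)"

locale weighted_naturally_oriented_tree = weighted_oriented_graph D w
  for D :: "'v pair_pre_digraph" and w :: "'v \<Rightarrow> nat" +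
  fixes x0 :: 'v
  assumes tree: "underlying_tree D"
    and root: "x0 \<in> pverts D"
    and oriented_away:
      "(x, y) \<in> parcs D \<Longrightarrow> underlying_dist D x0 x < underlying_dist D x0 y"

section \<open>Polynomials, monomial ideals and edge ideals\<close>

text \<open>
  A monomial is the multiset of its variables, so the product of monomials is multiset union
  \<open>+\<close>, divisibility is \<open>\<subseteq>#\<close>, and the least common multiple of a finite set of
  monomials is its supremum \<open>Sup\<close> (with \<open>Sup {} = {#}\<close>, the monomial 1).
  A polynomial is a finitely supported function from monomials to coefficients, multiplied by
  convolution.
\<close>

definition mpoly_ring :: "'v set \<Rightarrow> ('v multiset \<Rightarrow>\<^sub>0 'k::field) ring" where
  "mpoly_ring V =
     \<lparr>carrier = {p. \<forall>m \<in> Poly_Mapping.keys p. set_mset m \<subseteq> V},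
      mult = (*), one = 1, zero = 0, add = (+)\<rparr>"

definition mpoly_monom :: "'v multiset \<Rightarrow> ('v multiset \<Rightarrow>\<^sub>0 'k::field)" where
  "mpoly_monom m = Poly_Mapping.single m 1"

definition edge_ideal ::
  "'v pair_pre_digraph \<Rightarrow> ('v \<Rightarrow> nat) \<Rightarrow> ('v multiset \<Rightarrow>\<^sub>0 'k::field) set" where
  "edge_ideal D w =
     genideal (mpoly_ring (pverts D))
       {mpoly_monom ({#x#} + replicate_mset (w y) y) | x y. (x, y) \<in> parcs D}"

definition monomial_generators ::
  "'v set \<Rightarrow> ('v multiset \<Rightarrow>\<^sub>0 'k::field) set \<Rightarrow> 'v multiset set \<Rightarrow> bool" where
  "monomial_generators V I G \<longleftrightarrow>
     (\<forall>m \<in> G. set_mset m \<subseteq> V) \<and> genideal (mpoly_ring V) (mpoly_monom ` G) = I"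

definition minimal_monomial_generators ::
  "'v set \<Rightarrow> ('v multiset \<Rightarrow>\<^sub>0 'k::field) set \<Rightarrow> 'v multiset set \<Rightarrow> bool" where
  "minimal_monomial_generators V I G \<longleftrightarrow>
     monomial_generators V I G \<and> (\<forall>G'. G' \<subset> G \<longrightarrow> \<not> monomial_generators V I G')"

lemma cring_mpoly_ring: "cring (mpoly_ring V :: ('v multiset \<Rightarrow>\<^sub>0 'k::field) ring)"
proof (intro cringI abelian_groupI comm_monoidI, goal_cases)
  case (6 p)
  then show ?case
    by (intro bexI[of _ "- p"]) (auto simp: mpoly_ring_def)
next
  case (7 p q)
  then show ?case
    using keys_mult[of p q] by (fastforce simp: mpoly_ring_def)
qed (use Poly_Mapping.keys_add in \<open>fastforce simp: mpoly_ring_def algebra_simps\<close>)+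

section \<open>The Barile--Macchia algorithm\<close>

text \<open>
  A total ordering of the generators is given by the reflexive relation \<open>r\<close>, where
  \<open>(m, m') \<in> r\<close> means that \<open>m\<close> is smaller than or equal to \<open>m'\<close>.
\<close>

definition is_bridge :: "'v multiset \<Rightarrow> 'v multiset set \<Rightarrow> bool" where
  "is_bridge m \<sigma> \<longleftrightarrow> m \<in> \<sigma> \<and> Sup (\<sigma> - {m}) = Sup \<sigma>"

text \<open>
  The smallest bridge is a set with at most one element, empty if there is no bridge; so
  \<open>\<sigma> - smallest_bridge r \<sigma>\<close> also covers the convention for subsets without bridges.
\<close>

definition smallest_bridge ::
  "('v multiset \<times> 'v multiset) set \<Rightarrow> 'v multiset set \<Rightarrow> 'v multiset set" where
  "smallest_bridge r \<sigma> = {m. is_bridge m \<sigma> \<and> (\<forall>m'. is_bridge m' \<sigma> \<longrightarrow> (m, m') \<in> r)}"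

type_synonym 'v bm_edges = "('v multiset set \<times> 'v multiset set) set"

text \<open>
  One pass through steps (1) and (2) on a state \<open>(A, \<Omega>)\<close>. The algorithm leaves open which
  \<open>\<sigma>\<close> of maximal cardinality is picked, so this is a relation; the lemma
  \<open>bm_output_unique\<close> below shows that the choices do not affect the output.
\<close>

inductive bm_step ::
  "('v multiset \<times> 'v multiset) set \<Rightarrow> 'v bm_edges \<times> 'v multiset set set \<Rightarrow>
   'v bm_edges \<times> 'v multiset set set \<Rightarrow> bool"
  for r where
  "\<sigma> \<in> \<Omega> \<Longrightarrow> (\<And>\<tau>. \<tau> \<in> \<Omega> \<Longrightarrow> card \<tau> \<le> card \<sigma>) \<Longrightarrow>
   bm_step r (A, \<Omega>)
     (A \<union> (if smallest_bridge r \<sigma> = {} then {} else {(\<sigma>, \<sigma> - smallest_bridge r \<sigma>)}),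
      \<Omega> - {\<sigma>, \<sigma> - smallest_bridge r \<sigma>})"

definition bm_output ::
  "'v multiset set \<Rightarrow> ('v multiset \<times> 'v multiset) set \<Rightarrow> 'v bm_edges \<Rightarrow> bool" where
  "bm_output G r A \<longleftrightarrow> (bm_step r)\<^sup>*\<^sup>* ({}, {\<sigma>. \<sigma> \<subseteq> G \<and> 3 \<le> card \<sigma>}) (A, {})"

text \<open>
  Step (3). Of all edges with a given target, the repeated removal leaves exactly the one with
  the smallest bridge.
\<close>

definition bm_prune ::
  "('v multiset \<times> 'v multiset) set \<Rightarrow> 'v bm_edges \<Rightarrow> 'v bm_edges" where
  "bm_prune r A =
     {(\<sigma>, \<tau>) \<in> A. \<not> (\<exists>\<sigma>'. (\<sigma>', \<tau>) \<in> A \<and> \<sigma>' \<noteq> \<sigma> \<and>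
        (\<exists>m \<in> smallest_bridge r \<sigma>. \<exists>m' \<in> smallest_bridge r \<sigma>'. m' \<noteq> m \<and> (m', m) \<in> r))}"

definition potentially_type2 ::
  "('v multiset \<times> 'v multiset) set \<Rightarrow> 'v bm_edges \<Rightarrow> 'v multiset set \<Rightarrow> bool" where
  "potentially_type2 r A \<sigma> \<longleftrightarrow> (\<sigma>, \<sigma> - smallest_bridge r \<sigma>) \<in> A"

definition type2 ::
  "('v multiset \<times> 'v multiset) set \<Rightarrow> 'v bm_edges \<Rightarrow> 'v multiset set \<Rightarrow> bool" where
  "type2 r A \<sigma> \<longleftrightarrow> (\<sigma>, \<sigma> - smallest_bridge r \<sigma>) \<in> bm_prune r A"

definition bridge_friendly :: "'v set \<Rightarrow> ('v multiset \<Rightarrow>\<^sub>0 'k::field) set \<Rightarrow> bool" where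
  "bridge_friendly V I \<longleftrightarrow>
     (\<exists>G. minimal_monomial_generators V I G \<and>
       (\<exists>r. linear_order_on G r \<and>
         (\<forall>A. bm_output G r A \<longrightarrow>
           (\<forall>\<sigma>. potentially_type2 r A \<sigma> \<longrightarrow> type2 r A \<sigma>))))"

lemma bm_step_terminates:
  assumes "finite \<Omega>"
  shows "\<exists>A'. (bm_step r)\<^sup>*\<^sup>* (A, \<Omega>) (A', {})"
  using assms
proof (induction "card \<Omega>" arbitrary: A \<Omega> rule: less_induct)
  case less
  show ?case
  proof (cases "\<Omega> = {}")
    case False
    have "Max (card ` \<Omega>) \<in> card ` \<Omega>"
      using False less.prems by (intro Max_in) auto
    then obtain \<sigma> where s: "\<sigma> \<in> \<Omega>" "card \<sigma> = Max (card ` \<Omega>)" by auto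
    define A1 where
      "A1 = A \<union> (if smallest_bridge r \<sigma> = {} then {} else {(\<sigma>, \<sigma> - smallest_bridge r \<sigma>)})"
    define W where "W = \<Omega> - {\<sigma>, \<sigma> - smallest_bridge r \<sigma>}"
    have 1: "bm_step r (A, \<Omega>) (A1, W)"
      unfolding A1_def W_def using s less.prems by (intro bm_step.intros) auto
    have "card W < card \<Omega>"
      using s less.prems by (intro psubset_card_mono) (auto simp: W_def)
    moreover have "finite W"
      using less.prems by (simp add: W_def)
    ultimately obtain A' where "(bm_step r)\<^sup>*\<^sup>* (A1, W) (A', {})"
      using less.hyps by blast
    with 1 show ?thesis
      by (meson converse_rtranclp_into_rtranclp)
  qed blast
qed

lemma bm_output_exists: "finite G \<Longrightarrow> \<exists>A. bm_output G r A"
  unfolding bm_output_def by (rule bm_step_terminates) simp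

lemma card_diff_smallest_bridge:
  assumes "finite \<sigma>" "smallest_bridge r \<sigma> \<noteq> {}"
  shows "card (\<sigma> - smallest_bridge r \<sigma>) < card \<sigma>"
  using assms by (intro psubset_card_mono) (auto simp: smallest_bridge_def is_bridge_def)

lemma bm_step_diamond:
  assumes "bm_step r s t" "bm_step r s u" "t \<noteq> u" "\<forall>\<sigma> \<in> snd s. finite \<sigma>"
  shows "\<exists>v. bm_step r t v \<and> bm_step r u v"
proof -
  let ?b = "smallest_bridge r"
  let ?e = "\<lambda>\<sigma>. if ?b \<sigma> = {} then {} else {(\<sigma>, \<sigma> - ?b \<sigma>)}"
  obtain A \<Omega> where s: "s = (A, \<Omega>)" by force
  obtain \<sigma>1 where 1: "\<sigma>1 \<in> \<Omega>" "\<forall>\<tau> \<in> \<Omega>. card \<tau> \<le> card \<sigma>1"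
    "t = (A \<union> ?e \<sigma>1, \<Omega> - {\<sigma>1, \<sigma>1 - ?b \<sigma>1})"
    using assms(1) unfolding s by (auto elim!: bm_step.cases)
  obtain \<sigma>2 where 2: "\<sigma>2 \<in> \<Omega>" "\<forall>\<tau> \<in> \<Omega>. card \<tau> \<le> card \<sigma>2"
    "u = (A \<union> ?e \<sigma>2, \<Omega> - {\<sigma>2, \<sigma>2 - ?b \<sigma>2})"
    using assms(2) unfolding s by (auto elim!: bm_step.cases)
  have ne: "\<sigma>1 \<noteq> \<sigma>2" using assms(3) 1 2 by auto
  have eq: "card \<sigma>1 = card \<sigma>2" using 1 2 by (meson le_antisym)
  have fin: "finite \<sigma>1" "finite \<sigma>2" using assms(4) 1 2 s by auto
  have "\<sigma>2 \<noteq> \<sigma>1 - ?b \<sigma>1"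
    using card_diff_smallest_bridge[OF fin(1), of r] ne eq
    by (metis Diff_empty less_irrefl)
  moreover have "\<sigma>1 \<noteq> \<sigma>2 - ?b \<sigma>2"
    using card_diff_smallest_bridge[OF fin(2), of r] ne eq
    by (metis Diff_empty less_irrefl)
  ultimately have "bm_step r t ((A \<union> ?e \<sigma>1) \<union> ?e \<sigma>2, \<Omega> - {\<sigma>1, \<sigma>1 - ?b \<sigma>1} - {\<sigma>2, \<sigma>2 - ?b \<sigma>2})"
    and "bm_step r u ((A \<union> ?e \<sigma>2) \<union> ?e \<sigma>1, \<Omega> - {\<sigma>2, \<sigma>2 - ?b \<sigma>2} - {\<sigma>1, \<sigma>1 - ?b \<sigma>1})"
    unfolding 1(3) 2(3) using 1 2 ne by (intro bm_step.intros; auto)+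
  moreover have "((A \<union> ?e \<sigma>1) \<union> ?e \<sigma>2, \<Omega> - {\<sigma>1, \<sigma>1 - ?b \<sigma>1} - {\<sigma>2, \<sigma>2 - ?b \<sigma>2}) =
      ((A \<union> ?e \<sigma>2) \<union> ?e \<sigma>1, \<Omega> - {\<sigma>2, \<sigma>2 - ?b \<sigma>2} - {\<sigma>1, \<sigma>1 - ?b \<sigma>1})"
    by (intro prod_eqI) (auto simp only: fst_conv snd_conv Un_ac)
  ultimately show ?thesis by metis
qed

lemma bm_step_terminal_unique:
  assumes "finite (snd s)" "\<forall>\<sigma> \<in> snd s. finite \<sigma>"
    and "(bm_step r)\<^sup>*\<^sup>* s (A, {})" "(bm_step r)\<^sup>*\<^sup>* s (B, {})"
  shows "A = B"
  using assms
proof (induction "card (snd s)" arbitrary: s A B rule: less_induct)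
  case less
  have dec: "card (snd t) < card (snd s) \<and> finite (snd t) \<and> (\<forall>\<sigma> \<in> snd t. finite \<sigma>)"
    if "bm_step r s t" for t
    using that less.prems(1,2) by cases (auto intro!: psubset_card_mono)
  show ?case
  proof (cases "snd s = {}")
    case True
    then have "\<not> bm_step r s t" for t using dec[of t] by auto
    then show ?thesis
      using less.prems(3,4) by (metis converse_rtranclpE prod.inject)
  next
    case False
    then obtain t where t: "bm_step r s t" "(bm_step r)\<^sup>*\<^sup>* t (A, {})"
      using less.prems(3) by (metis converse_rtranclpE snd_conv)
    from False obtain u where u: "bm_step r s u" "(bm_step r)\<^sup>*\<^sup>* u (B, {})"
      using less.prems(4) by (metis converse_rtranclpE snd_conv)
    show ?thesis
    proof (cases "t = u")
      case True
      then show ?thesis using less.hyps[of t A B] dec t u by blast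
    next
      case neq: False
      obtain v where v: "bm_step r t v" "bm_step r u v"
        using bm_step_diamond[OF t(1) u(1) neq less.prems(2)] by blast
      have "finite (snd v)"
        using v(1) dec[OF t(1)] by cases auto
      then obtain C where C: "(bm_step r)\<^sup>*\<^sup>* v (C, {})"
        using bm_step_terminates[of "snd v" r "fst v"] by auto
      have "A = C"
        using less.hyps[of t A C] dec[OF t(1)] t(2) v(1) C
        by (meson converse_rtranclp_into_rtranclp)
      moreover have "B = C"
        using less.hyps[of u B C] dec[OF u(1)] u(2) v(2) C
        by (meson converse_rtranclp_into_rtranclp)
      ultimately show ?thesis by simp
    qed
  qed
qed

lemma bm_output_unique:
  assumes "finite G" "bm_output G r A" "bm_output G r B"
  shows "A = B"
proof (rule bm_step_terminal_unique)
  let ?s = "({}, {\<sigma>. \<sigma> \<subseteq> G \<and> 3 \<le> card \<sigma>}) :: 'a bm_edges \<times> 'a multiset set set"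
  show "finite (snd ?s)"
    using assms(1) by simp
  show "\<forall>\<sigma> \<in> snd ?s. finite \<sigma>"
    using finite_subset[OF _ assms(1)] by simp
  show "(bm_step r)\<^sup>*\<^sup>* ?s (A, {})" "(bm_step r)\<^sup>*\<^sup>* ?s (B, {})"
    using assms(2,3) unfolding bm_output_def .
qed

end

theory Submission
  imports Defs
begin

text \<open>
  The generators of the edge ideal correspond to the arcs of the tree, and the bridges can be read
  off from the tree. An arc \<open>(p, c)\<close> in a set \<open>\<sigma>\<close> is a bridge when the exponents of
  \<open>p\<close> and \<open>c\<close> in its monomial are reached by other arcs of \<open>\<sigma>\<close>. For \<open>p\<close> this
  takes the arc into \<open>p\<close> or another arc out of \<open>p\<close>; for \<open>c\<close>, which has only one parent,
  it takes an arc out of \<open>c\<close> and weight 1 at \<open>c\<close>. The generators are ordered by depth,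
  deeper arcs first, so that a bridge is always larger than the arcs below it.

  In a run of the algorithm, a set of at least three generators with a bridge is either the source
  or the target of an edge, never both. The key fact (\<open>source_has_no_gap\<close>) is that a source
  \<open>\<sigma>\<close> admits no \<open>c \<notin> \<sigma>\<close> that is the smallest bridge of \<open>\<sigma> \<union> {c}\<close>: for the
  smallest such \<open>c\<close>, the shape of bridges in a tree shows that \<open>\<sigma> \<union> {c}\<close> is not a target, so
  it is a source, and its target is \<open>\<sigma>\<close>.

  Suppose two sources \<open>\<tau> \<union> {a}\<close> and \<open>\<tau> \<union> {b}\<close> with smallest bridges \<open>a < b\<close> had
  the same target \<open>\<tau>\<close>. Then \<open>a\<close> is the smallest bridge of \<open>\<tau> \<union> {a, b}\<close>: a smaller
  bridge \<open>c\<close> would be larger than the arcs below it, so \<open>a\<close> and \<open>b\<close> are not below \<open>c\<close>,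
  and \<open>c\<close> would be a bridge of one of the two sources already. This contradicts the key fact for
  \<open>\<tau> \<union> {b}\<close>. Hence step (3) of the algorithm removes nothing (\<open>sources_with_same_target\<close>).

  It remains to see that each vertex has at most one parent (\<open>unique_parent\<close>), where the
  absence of undirected cycles enters, and that the arc monomials, having pairwise distinct
  supports of two variables, generate the ideal minimally
  (\<open>antichain_minimal_monomial_generators\<close>).
\<close>

section \<open>Sources and targets of the edges of a run\<close>

text \<open>
  The clause on cardinalities is what keeps sources and targets disjoint: a set that is picked
  later is no larger than any earlier source, so its target is strictly smaller than all of them
  and cannot be one of them. Conversely, no picked set is an earlier target, because targets
  leave \<open>\<Omega>\<close>.
\<close>

definition bm_invariant :: "'v multiset set \<Rightarrow> ('v multiset \<times> 'v multiset) set \<Rightarrow>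
    'v bm_edges \<Rightarrow> 'v multiset set set \<Rightarrow> bool" where
  "bm_invariant G r A \<Omega> \<longleftrightarrow>
     (\<forall>\<sigma> \<in> \<Omega>. \<sigma> \<subseteq> G \<and> 3 \<le> card \<sigma>) \<and>
     (\<forall>\<sigma> \<tau>. (\<sigma>, \<tau>) \<in> A \<longrightarrow> \<sigma> \<subseteq> G \<and> 3 \<le> card \<sigma> \<and> smallest_bridge r \<sigma> \<noteq> {} \<and>
        \<tau> = \<sigma> - smallest_bridge r \<sigma> \<and> \<tau> \<notin> \<Omega> \<and> (\<forall>\<rho> \<in> \<Omega>. card \<rho> \<le> card \<sigma>)) \<and>
     Domain A \<inter> Range A = {} \<and>
     (\<forall>\<sigma>. \<sigma> \<subseteq> G \<and> 3 \<le> card \<sigma> \<and> smallest_bridge r \<sigma> \<noteq> {} \<longrightarrow>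
        \<sigma> \<in> \<Omega> \<union> Domain A \<union> Range A)"

lemma bm_invariant_step:
  assumes fin: "finite G" and inv: "bm_invariant G r A \<Omega>" and step: "bm_step r (A, \<Omega>) (A', \<Omega>')"
  shows "bm_invariant G r A' \<Omega>'"
proof -
  let ?b = "smallest_bridge r"
  from step obtain \<sigma> where \<sigma>: "\<sigma> \<in> \<Omega>" "\<And>\<tau>. \<tau> \<in> \<Omega> \<Longrightarrow> card \<tau> \<le> card \<sigma>"
    and A': "A' = A \<union> (if ?b \<sigma> = {} then {} else {(\<sigma>, \<sigma> - ?b \<sigma>)})"
    and \<Omega>': "\<Omega>' = \<Omega> - {\<sigma>, \<sigma> - ?b \<sigma>}"
    by (cases rule: bm_step.cases) auto
  note inv = inv[unfolded bm_invariant_def]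
  have I1: "\<rho> \<subseteq> G \<and> 3 \<le> card \<rho>" if "\<rho> \<in> \<Omega>" for \<rho>
    using inv that by simp
  have I2: "\<rho> \<subseteq> G \<and> 3 \<le> card \<rho> \<and> ?b \<rho> \<noteq> {} \<and> \<tau> = \<rho> - ?b \<rho> \<and> \<tau> \<notin> \<Omega> \<and>
      (\<forall>\<pi> \<in> \<Omega>. card \<pi> \<le> card \<rho>)" if "(\<rho>, \<tau>) \<in> A" for \<rho> \<tau>
    using inv that by simp
  have I3: "Domain A \<inter> Range A = {}" using inv by simp
  have I4: "\<rho> \<in> \<Omega> \<union> Domain A \<union> Range A" if "\<rho> \<subseteq> G" "3 \<le> card \<rho>" "?b \<rho> \<noteq> {}" for \<rho>
    using inv that by simp
  show ?thesis
  proof (cases "?b \<sigma> = {}")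
    case True
    have "A' = A" "\<Omega>' = \<Omega> - {\<sigma>}" using True A' \<Omega>' by auto
    moreover have "\<rho> \<in> \<Omega>' \<union> Domain A \<union> Range A" if "\<rho> \<subseteq> G" "3 \<le> card \<rho>" "?b \<rho> \<noteq> {}" for \<rho>
      using I4[OF that] that(3) True \<open>\<Omega>' = \<Omega> - {\<sigma>}\<close> by blast
    ultimately show ?thesis
      using I1 I2 I3 unfolding bm_invariant_def by simp
  next
    case False
    let ?\<tau> = "\<sigma> - ?b \<sigma>"
    have A'': "A' = insert (\<sigma>, ?\<tau>) A" using False A' by auto
    have "finite \<sigma>" using I1[OF \<sigma>(1)] fin finite_subset by blast
    then have less: "card ?\<tau> < card \<sigma>" using False by (rule card_diff_smallest_bridge)
    then have ne: "\<sigma> \<noteq> ?\<tau>" by auto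
    have "\<sigma> \<notin> Range A" using I2 \<sigma>(1) by blast
    moreover have "?\<tau> \<notin> Domain A"
    proof
      assume "?\<tau> \<in> Domain A"
      then have "card \<sigma> \<le> card ?\<tau>" using I2 \<sigma>(1) by blast
      with less show False by simp
    qed
    ultimately have "Domain A' \<inter> Range A' = {}" using I3 ne unfolding A'' by auto
    moreover have "\<rho> \<in> \<Omega>' \<union> Domain A' \<union> Range A'" if "\<rho> \<subseteq> G" "3 \<le> card \<rho>" "?b \<rho> \<noteq> {}" for \<rho>
      using I4[OF that] unfolding A'' \<Omega>' by blast
    moreover have "\<rho> \<subseteq> G \<and> 3 \<le> card \<rho>" if "\<rho> \<in> \<Omega>'" for \<rho> using that I1 unfolding \<Omega>' by blast
    moreover have "\<rho> \<subseteq> G \<and> 3 \<le> card \<rho> \<and> ?b \<rho> \<noteq> {} \<and> \<tau> = \<rho> - ?b \<rho> \<and> \<tau> \<notin> \<Omega>' \<and>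
        (\<forall>\<pi> \<in> \<Omega>'. card \<pi> \<le> card \<rho>)" if "(\<rho>, \<tau>) \<in> A'" for \<rho> \<tau>
    proof (cases "(\<rho>, \<tau>) \<in> A")
      case True
      from I2[OF this] show ?thesis unfolding \<Omega>' by blast
    next
      case new: False
      then have "\<rho> = \<sigma>" "\<tau> = ?\<tau>" using that unfolding A'' by simp_all
      then show ?thesis using I1[OF \<sigma>(1)] \<sigma>(2) False unfolding \<Omega>' by simp
    qed
    ultimately show ?thesis unfolding bm_invariant_def by simp
  qed
qed

lemma bm_invariant_output:
  assumes fin: "finite G" and out: "bm_output G r A"
  shows "bm_invariant G r A {}"
proof -
  have "bm_invariant G r (fst s) (snd s)"
    if "(bm_step r)\<^sup>*\<^sup>* ({}, {\<sigma>. \<sigma> \<subseteq> G \<and> 3 \<le> card \<sigma>}) s" for s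
    using that
  proof (induction rule: rtranclp_induct)
    case base
    then show ?case by (simp add: bm_invariant_def)
  next
    case (step s t)
    then show ?case using bm_invariant_step[OF fin, of r "fst s" "snd s" "fst t" "snd t"] by simp
  qed
  from this[OF out[unfolded bm_output_def]] show ?thesis by simp
qed

text \<open>
  This lemma and the next determine the edge set without reference to the run: a set with at
  least three elements and a bridge is either a source or a target, and never both.
\<close>

lemma bm_output_edge:
  assumes "finite G" "bm_output G r A" "(\<sigma>, \<tau>) \<in> A"
  shows "\<sigma> \<subseteq> G" "3 \<le> card \<sigma>" "smallest_bridge r \<sigma> \<noteq> {}" "\<tau> = \<sigma> - smallest_bridge r \<sigma>"
    "(\<rho>, \<sigma>) \<notin> A"
  using bm_invariant_output[OF assms(1,2)] assms(3) unfolding bm_invariant_def by simp_all blast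

lemma bm_output_covers:
  assumes "finite G" "bm_output G r A" "\<sigma> \<subseteq> G" "3 \<le> card \<sigma>" "smallest_bridge r \<sigma> \<noteq> {}"
  shows "(\<exists>\<tau>. (\<sigma>, \<tau>) \<in> A) \<or> (\<exists>\<rho>. (\<rho>, \<sigma>) \<in> A)"
  using bm_invariant_output[OF assms(1,2)] assms(3-) unfolding bm_invariant_def by auto

lemma smallest_bridge_eq:
  assumes "antisym r" "m \<in> smallest_bridge r \<sigma>"
  shows "smallest_bridge r \<sigma> = {m}"
  using assms unfolding smallest_bridge_def by (auto dest: antisymD)

section \<open>Bridges with local witnesses\<close>

text \<open>
  The argument uses only how bridges arise. A generator \<open>m\<close> of \<open>\<sigma>\<close> is a bridge
  when \<open>\<sigma>\<close> contains a witness in \<open>lower m\<close> and a witness in \<open>upper m\<close>; the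
  lower witnesses precede \<open>m\<close> in the order. For the edge ideal of a tree, \<open>m\<close> stands for
  an edge, \<open>lower m\<close> for the edges leaving its far end, and \<open>upper m\<close> for the other edges
  at its near end. The exchange condition then holds because an edge \<open>c\<close> in \<open>upper m\<close> is
  either the parent edge of \<open>m\<close>, with \<open>m\<close> and its siblings below it, or a sibling
  of \<open>m\<close>, with the same upper edges up to exchanging the two.
\<close>

locale local_bridges =
  fixes G :: "'v multiset set" and r :: "('v multiset \<times> 'v multiset) set"
    and lower upper :: "'v multiset \<Rightarrow> 'v multiset set"
  assumes finite_gens: "finite G"
    and linear: "linear_order_on G r"
    and bridge_iff: "\<sigma> \<subseteq> G \<Longrightarrow>
      is_bridge m \<sigma> \<longleftrightarrow> m \<in> \<sigma> \<and> lower m \<inter> \<sigma> \<noteq> {} \<and> upper m \<inter> \<sigma> \<noteq> {}"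
    and lower_less: "m \<in> G \<Longrightarrow> c \<in> lower m \<Longrightarrow> (m, c) \<notin> r"
    and upper_irrefl: "m \<notin> upper m"
    and upper_exchange: "m \<in> G \<Longrightarrow> c \<in> upper m \<Longrightarrow>
      lower c \<subseteq> insert m (upper m) \<or> upper c \<subseteq> insert m (upper m)"
begin

lemma order_antisym: "antisym r" and order_refl: "m \<in> G \<Longrightarrow> (m, m) \<in> r"
  and order_total: "m \<in> G \<Longrightarrow> c \<in> G \<Longrightarrow> m \<noteq> c \<Longrightarrow> (m, c) \<in> r \<or> (c, m) \<in> r"
  using linear unfolding linear_order_on_def partial_order_on_def preorder_on_def
  by (auto simp: refl_on_def total_on_def)

lemma order_trans: "(a, b) \<in> r \<Longrightarrow> (b, c) \<in> r \<Longrightarrow> (a, c) \<in> r"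
  using linear unfolding linear_order_on_def partial_order_on_def preorder_on_def
  by (meson transD)

lemma lower_irrefl: "m \<in> G \<Longrightarrow> m \<notin> lower m"
  using lower_less order_refl by blast

lemma bridge_mono:
  assumes "\<rho> \<subseteq> G" "\<sigma> \<subseteq> \<rho>" "is_bridge m \<sigma>"
  shows "is_bridge m \<rho>"
  using assms bridge_iff[of \<sigma> m] bridge_iff[of \<rho> m] by blast

lemma exists_minimal:
  assumes "S \<subseteq> G" "S \<noteq> {}"
  shows "\<exists>m \<in> S. \<forall>c \<in> S. (m, c) \<in> r"
proof -
  have "finite S" using assms(1) finite_gens finite_subset by blast
  then show ?thesis using assms(2,1)
  proof (induction rule: finite_ne_induct)
    case (singleton x)
    then show ?case using order_refl by auto
  next
    case (insert x F)
    then obtain m where m: "m \<in> F" "\<forall>c \<in> F. (m, c) \<in> r" by auto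
    consider "(m, x) \<in> r" | "(x, m) \<in> r" using order_total insert m order_refl by blast
    then show ?case
    proof cases
      case 1 then show ?thesis using m by auto
    next
      case 2
      then show ?thesis using m insert.prems order_refl order_trans by blast
    qed
  qed
qed

lemma smallest_bridge_exists:
  assumes "\<sigma> \<subseteq> G" "is_bridge m \<sigma>"
  shows "\<exists>a. smallest_bridge r \<sigma> = {a}"
proof -
  have "{c. is_bridge c \<sigma>} \<subseteq> G" "{c. is_bridge c \<sigma>} \<noteq> {}"
    using assms bridge_iff by blast+
  from exists_minimal[OF this] obtain a where "a \<in> smallest_bridge r \<sigma>"
    unfolding smallest_bridge_def by auto
  then show ?thesis using smallest_bridge_eq[OF order_antisym] by blast
qed

lemma smallest_bridgeD:
  assumes "smallest_bridge r \<sigma> = {a}"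
  shows "is_bridge a \<sigma>" "a \<in> \<sigma>" "is_bridge c \<sigma> \<Longrightarrow> (a, c) \<in> r"
proof -
  have "a \<in> smallest_bridge r \<sigma>" using assms by simp
  then show "is_bridge a \<sigma>" "is_bridge c \<sigma> \<Longrightarrow> (a, c) \<in> r" "a \<in> \<sigma>"
    unfolding smallest_bridge_def is_bridge_def by auto
qed

text \<open>
  If \<open>c\<close> is the smallest bridge of \<open>insert c \<sigma>\<close>, then \<open>insert c \<sigma>\<close> ought to be the
  source of an edge to \<open>\<sigma>\<close>, which a source \<open>\<sigma>\<close> cannot receive. What could prevent this is
  that \<open>insert c \<sigma>\<close> is itself the target of some \<open>insert d (insert c \<sigma>)\<close> with
  \<open>d\<close> smaller than \<open>c\<close>. With \<open>c\<close> chosen minimal (the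
  \<open>e\<close> of the proof), \<open>d\<close> cannot be a bridge of \<open>insert d \<sigma>\<close>, so it relies on \<open>c\<close> as a witness. Since \<open>c\<close> is larger than
  \<open>d\<close>, it is the only upper witness, and the exchange condition turns one of the two
  witnesses of \<open>c\<close> in \<open>\<sigma>\<close> into an upper witness of \<open>d\<close> in \<open>\<sigma>\<close>.
\<close>

lemma source_has_no_gap:
  assumes out: "bm_output G r A" and edge: "(\<sigma>, \<tau>) \<in> A" and c: "c \<in> G" "c \<notin> \<sigma>"
  shows "smallest_bridge r (insert c \<sigma>) \<noteq> {c}"
proof
  assume "smallest_bridge r (insert c \<sigma>) = {c}"
  note \<sigma> = bm_output_edge[OF finite_gens out edge]
  let ?S = "{c \<in> G - \<sigma>. smallest_bridge r (insert c \<sigma>) = {c}}"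
  have "?S \<noteq> {}" using c \<open>smallest_bridge r (insert c \<sigma>) = {c}\<close> by blast
  then obtain e where e: "e \<in> G" "e \<notin> \<sigma>" "smallest_bridge r (insert e \<sigma>) = {e}"
    and e_min: "\<And>d. d \<in> ?S \<Longrightarrow> (e, d) \<in> r"
    using exists_minimal[of ?S] by blast
  have fin: "finite \<sigma>" using \<sigma>(1) finite_gens finite_subset by blast
  have sub: "insert e \<sigma> \<subseteq> G" "3 \<le> card (insert e \<sigma>)"
    using \<sigma>(1,2) e fin by auto
  from bm_output_covers[OF finite_gens out sub] e(3)
  consider (source) \<tau>' where "(insert e \<sigma>, \<tau>') \<in> A" | (target) \<rho> where "(\<rho>, insert e \<sigma>) \<in> A"
    by auto
  then show False
  proof cases
    case source
    then have "\<tau>' = \<sigma>" using bm_output_edge(4)[OF finite_gens out source] e by simp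
    then show False using source \<sigma>(5) by blast
  next
    case target
    note \<rho> = bm_output_edge[OF finite_gens out target]
    obtain d where d: "smallest_bridge r \<rho> = {d}"
      using \<rho>(3) smallest_bridge_eq[OF order_antisym] by blast
    then have \<rho>_eq: "\<rho> = insert d (insert e \<sigma>)" and d_notin: "d \<notin> insert e \<sigma>"
      using \<rho>(4) smallest_bridgeD(2)[OF d] by auto
    have dG: "d \<in> G" using \<rho>(1) \<rho>_eq by blast
    have "is_bridge e \<rho>"
      using bridge_mono[OF \<rho>(1) _ smallest_bridgeD(1)[OF e(3)]] \<rho>_eq by blast
    then have de: "(d, e) \<in> r" using smallest_bridgeD(3)[OF d] by blast
    \<comment> \<open>otherwise \<open>d\<close> would be a candidate below the minimal \<open>e\<close>\<close>
    have not_gap: "\<not> is_bridge d (insert d \<sigma>)"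
    proof
      assume br: "is_bridge d (insert d \<sigma>)"
      have "(d, c) \<in> r" if "is_bridge c (insert d \<sigma>)" for c
        using smallest_bridgeD(3)[OF d] bridge_mono[OF \<rho>(1) _ that] \<rho>_eq by blast
      then have "smallest_bridge r (insert d \<sigma>) = {d}"
        using br by (intro smallest_bridge_eq[OF order_antisym]) (auto simp: smallest_bridge_def)
      then have "(e, d) \<in> r" using e_min dG d_notin by auto
      then show False using de d_notin order_antisym by (auto dest: antisymD)
    qed
    have sub_d: "insert d \<sigma> \<subseteq> G" using \<rho>(1) \<rho>_eq by blast
    have d_br: "lower d \<inter> \<rho> \<noteq> {}" "upper d \<inter> \<rho> \<noteq> {}"
      using smallest_bridgeD(1)[OF d] bridge_iff[OF \<rho>(1)] by blast+
    have "e \<notin> lower d" using lower_less dG de by blast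
    then have "lower d \<inter> insert d \<sigma> \<noteq> {}" using d_br \<rho>_eq by blast
    then have no_upper: "upper d \<inter> insert d \<sigma> = {}" using not_gap bridge_iff[OF sub_d] by blast
    then have "e \<in> upper d" using d_br \<rho>_eq by blast
    from upper_exchange[OF dG this] no_upper d_notin
    have "lower e \<inter> \<sigma> = {} \<or> upper e \<inter> \<sigma> = {}" by blast
    moreover have "lower e \<inter> insert e \<sigma> \<noteq> {}" "upper e \<inter> insert e \<sigma> \<noteq> {}"
      using smallest_bridgeD(1)[OF e(3)] bridge_iff[OF sub(1)] by blast+
    ultimately show False using lower_irrefl[OF e(1)] upper_irrefl[of e] by blast
  qed
qed

text \<open>
  Let \<open>\<tau>\<close> be the common target, so the sources are \<open>insert a \<tau>\<close> and \<open>insert b \<tau>\<close>.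
  If \<open>a\<close> is the smallest bridge of \<open>insert a (insert b \<tau>)\<close>, then
  \<open>source_has_no_gap\<close> forbids \<open>insert b \<tau>\<close> to be a source. A smaller bridge \<open>c\<close> would
  need both \<open>a\<close> and \<open>b\<close> as witnesses, being a bridge of neither source. But \<open>c\<close> is
  smaller than both, so neither is a lower witness, and one source already contains all that \<open>c\<close>
  needs.
\<close>

lemma sources_with_same_target:
  assumes out: "bm_output G r A" and 1: "(\<sigma>, \<tau>) \<in> A" and 2: "(\<sigma>', \<tau>) \<in> A"
    and a: "smallest_bridge r \<sigma> = {a}" and b: "smallest_bridge r \<sigma>' = {b}" and ab: "(a, b) \<in> r"
  shows "a = b"
proof (rule ccontr)
  assume "a \<noteq> b"
  note \<sigma> = bm_output_edge[OF finite_gens out 1]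
  note \<sigma>' = bm_output_edge[OF finite_gens out 2]
  have eqs: "\<sigma> = insert a \<tau>" "\<sigma>' = insert b \<tau>" "a \<notin> \<tau>" "b \<notin> \<tau>"
    using \<sigma>(4) \<sigma>'(4) a b smallest_bridgeD(2)[OF a] smallest_bridgeD(2)[OF b] by auto
  let ?\<rho> = "insert a \<sigma>'"
  have \<rho>: "?\<rho> = insert a (insert b \<tau>)" "?\<rho> \<subseteq> G" using eqs \<sigma>(1) \<sigma>'(1) by auto
  have abG: "a \<in> G" "b \<in> G" using \<rho> by auto
  have a_br: "is_bridge a ?\<rho>"
    using bridge_mono[OF \<rho>(2) _ smallest_bridgeD(1)[OF a]] eqs by blast
  then obtain c where c: "smallest_bridge r ?\<rho> = {c}" using smallest_bridge_exists \<rho> by blast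
  have ca: "(c, a) \<in> r" using smallest_bridgeD(3)[OF c a_br] .
  have "c = a"
  proof (rule ccontr)
    assume "c \<noteq> a"
    have cb: "(c, b) \<in> r" using order_trans ca ab by blast
    have "c \<noteq> b" using ca ab \<open>a \<noteq> b\<close> order_antisym by (auto dest: antisymD)
    have cG: "c \<in> G" using smallest_bridgeD(2)[OF c] \<rho> by blast
    have "\<not> is_bridge c \<sigma>"
      using smallest_bridgeD(3)[OF a] ca \<open>c \<noteq> a\<close> order_antisym by (auto dest: antisymD)
    moreover have "\<not> is_bridge c \<sigma>'"
      using smallest_bridgeD(3)[OF b] cb \<open>c \<noteq> b\<close> order_antisym by (auto dest: antisymD)
    moreover have "c \<in> \<tau>" "lower c \<inter> ?\<rho> \<noteq> {}" "upper c \<inter> ?\<rho> \<noteq> {}"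
      using smallest_bridgeD(1)[OF c] bridge_iff[OF \<rho>(2)] \<open>c \<noteq> a\<close> \<open>c \<noteq> b\<close> \<rho> by auto
    moreover have "a \<notin> lower c" "b \<notin> lower c" using lower_less[OF cG] ca cb by blast+
    ultimately show False
      using bridge_iff[OF \<sigma>(1)] bridge_iff[OF \<sigma>'(1)] eqs by blast
  qed
  moreover have "a \<notin> \<sigma>'" using eqs \<open>a \<noteq> b\<close> by blast
  ultimately show False using source_has_no_gap[OF out 2 abG(1)] c by blast
qed

lemma potentially_type2_imp_type2:
  assumes out: "bm_output G r A" and pot: "potentially_type2 r A \<sigma>"
  shows "type2 r A \<sigma>"
proof -
  let ?\<tau> = "\<sigma> - smallest_bridge r \<sigma>"
  have edge: "(\<sigma>, ?\<tau>) \<in> A" using pot unfolding potentially_type2_def .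
  have False
    if "(\<sigma>', ?\<tau>) \<in> A" "m \<in> smallest_bridge r \<sigma>" "m' \<in> smallest_bridge r \<sigma>'" "m' \<noteq> m" "(m', m) \<in> r"
    for \<sigma>' m m'
    using sources_with_same_target[OF out that(1) edge] that smallest_bridge_eq[OF order_antisym] by blast
  then show ?thesis
    using edge unfolding type2_def bm_prune_def by auto
qed

end

section \<open>Bridges and divisibility of exponents\<close>

text \<open>
  Least common multiples are computed one variable at a time, so \<open>m\<close> can be dropped exactly
  when each of its exponents is reached by some other element. Only the variables of \<open>m\<close>
  are tested, so that \<open>\<sigma> = {{#}}\<close> is covered: there \<open>m = {#}\<close> is a bridge, because the
  empty lcm is 1.
\<close>

lemma is_bridge_iff:
  assumes fin: "finite \<sigma>"
  shows "is_bridge m \<sigma> \<longleftrightarrow>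
    m \<in> \<sigma> \<and> (\<forall>x \<in># m. \<exists>m' \<in> \<sigma> - {m}. count m x \<le> count m' x)"
proof (cases "m \<in> \<sigma>")
  case True
  let ?S = "\<sigma> - {m}"
  have bdd: "subset_mset.bdd_above ?S"
    using fin by (intro subset_mset.bdd_above_finite finite_Diff)
  show ?thesis
  proof (cases "?S = {}")
    case True
    then have "\<sigma> = {m}" using \<open>m \<in> \<sigma>\<close> by blast
    then show ?thesis
      by (auto simp: is_bridge_def Sup_multiset_empty subset_mset.cSup_singleton)
  next
    case False
    have "Sup \<sigma> = m \<union># Sup ?S"
      using subset_mset.cSup_insert[OF False bdd, of m] True by (simp add: insert_absorb)
    then have "Sup ?S = Sup \<sigma> \<longleftrightarrow> m \<subseteq># Sup ?S"
      by (metis subset_mset.le_iff_sup)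
    also have "\<dots> \<longleftrightarrow> (\<forall>x. count m x \<le> (SUP X\<in>?S. count X x))"
      by (simp add: subseteq_mset_def count_Sup_multiset_nonempty[OF False bdd])
    also have "\<dots> \<longleftrightarrow> (\<forall>x. \<exists>m' \<in> ?S. count m x \<le> count m' x)"
    proof -
      have "(SUP X\<in>?S. count X x) = Max ((\<lambda>X. count X x) ` ?S)" for x
        using False fin by (intro cSup_eq_Max) auto
      then show ?thesis using False fin by (simp add: Max_ge_iff)
    qed
    also have "\<dots> \<longleftrightarrow> (\<forall>x \<in># m. \<exists>m' \<in> ?S. count m x \<le> count m' x)"
      using False by (metis all_not_in_conv not_in_iff zero_le)
    finally show ?thesis using True by (simp add: is_bridge_def)
  qed
qed (simp add: is_bridge_def)

section \<open>Minimal generators of monomial ideals\<close>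

lemma carrier_mpoly_ring [simp]:
  "carrier (mpoly_ring V) = {p. \<forall>m \<in> Poly_Mapping.keys p. set_mset m \<subseteq> V}"
  by (simp add: mpoly_ring_def)

lemma keys_mpoly_monom [simp]: "Poly_Mapping.keys (mpoly_monom m :: _ \<Rightarrow>\<^sub>0 'k::field) = {m}"
  by (simp add: mpoly_monom_def)

text \<open>
  The polynomials all of whose monomials are divisible by an element of \<open>G\<close> form an ideal
  that contains \<open>G\<close>.
\<close>

lemma genideal_keys:
  fixes p :: "'v multiset \<Rightarrow>\<^sub>0 'k::field"
  assumes "\<forall>m \<in> G. set_mset m \<subseteq> V"
    and "p \<in> genideal (mpoly_ring V) (mpoly_monom ` G)" and "k \<in> Poly_Mapping.keys p"
  shows "\<exists>m \<in> G. m \<subseteq># k"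
proof -
  let ?R = "mpoly_ring V :: ('v multiset \<Rightarrow>\<^sub>0 'k) ring"
  let ?J = "{p \<in> carrier ?R. \<forall>k \<in> Poly_Mapping.keys p. \<exists>m \<in> G. m \<subseteq># k}"
  interpret cring ?R by (rule cring_mpoly_ring)
  have mult_keys: "\<exists>m \<in> G. m \<subseteq># k"
    if "\<forall>k \<in> Poly_Mapping.keys q. \<exists>m \<in> G. m \<subseteq># k" "k \<in> Poly_Mapping.keys (q * s)"
    for q s :: "'v multiset \<Rightarrow>\<^sub>0 'k" and k
  proof -
    obtain i j where ij: "k = i + j" "i \<in> Poly_Mapping.keys q"
      using keys_mult[of q s] \<open>k \<in> _\<close> by auto
    with that(1) obtain m where "m \<in> G" "m \<subseteq># i" by blast
    then show ?thesis
      using ij(1) by (metis mset_subset_eq_add_left subset_mset.order_trans)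
  qed
  have "ideal ?J ?R"
  proof (rule idealI)
    show "ring ?R" by (rule ring_axioms)
    show "subgroup ?J (add_monoid ?R)"
    proof (unfold_locales, goal_cases)
      case (2 p q)
      then show ?case using Poly_Mapping.keys_add[of p q] by (fastforce simp: mpoly_ring_def)
    next
      case (4 p)
      have "- p \<in> carrier ?R" using 4 by simp
      moreover have "p \<oplus>\<^bsub>?R\<^esub> - p = \<zero>\<^bsub>?R\<^esub>" by (simp add: mpoly_ring_def)
      ultimately have "\<ominus>\<^bsub>?R\<^esub> p = - p"
        using 4 by (intro sum_zero_eq_neg[symmetric]) (auto simp: mpoly_ring_def)
      then show ?case using 4 by (simp add: a_inv_def)
    qed (auto simp: mpoly_ring_def)
  next
    fix a x assume ax: "a \<in> ?J" "x \<in> carrier ?R"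
    then have "a \<otimes>\<^bsub>?R\<^esub> x \<in> carrier ?R" by blast
    moreover have "a \<otimes>\<^bsub>?R\<^esub> x = a * x" by (simp add: mpoly_ring_def)
    ultimately show "a \<otimes>\<^bsub>?R\<^esub> x \<in> ?J" using mult_keys ax by auto
    moreover have "x \<otimes>\<^bsub>?R\<^esub> a = a \<otimes>\<^bsub>?R\<^esub> x" using ax m_comm by blast
    ultimately show "x \<otimes>\<^bsub>?R\<^esub> a \<in> ?J" by simp
  qed
  moreover have "mpoly_monom ` G \<subseteq> ?J" using assms(1) by auto
  ultimately have "genideal ?R (mpoly_monom ` G) \<subseteq> ?J" by (rule genideal_minimal)
  then show ?thesis using assms(2,3) by blast
qed

lemma antichain_minimal_monomial_generators:
  assumes sub: "\<forall>m \<in> G. set_mset m \<subseteq> V"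
    and anti: "\<And>m m'. m \<in> G \<Longrightarrow> m' \<in> G \<Longrightarrow> m \<subseteq># m' \<Longrightarrow> m = m'"
  shows "minimal_monomial_generators V
    (genideal (mpoly_ring V) (mpoly_monom ` G) :: ('v multiset \<Rightarrow>\<^sub>0 'k::field) set) G"
proof -
  let ?R = "mpoly_ring V :: ('v multiset \<Rightarrow>\<^sub>0 'k) ring"
  interpret cring ?R by (rule cring_mpoly_ring)
  have False if G': "G' \<subset> G"
    and eq: "genideal ?R (mpoly_monom ` G') = genideal ?R (mpoly_monom ` G)" for G'
  proof -
    obtain m where m: "m \<in> G" "m \<notin> G'" using G' by blast
    have "mpoly_monom ` G \<subseteq> carrier ?R" using sub by auto
    then have "mpoly_monom m \<in> genideal ?R (mpoly_monom ` G)"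
      using genideal_self m(1) by blast
    then obtain m' where "m' \<in> G'" "m' \<subseteq># m"
      using genideal_keys[of G' V "mpoly_monom m :: _ \<Rightarrow>\<^sub>0 'k" m] sub G' eq by auto
    then show False using anti m G' by blast
  qed
  then show ?thesis
    using sub unfolding minimal_monomial_generators_def monomial_generators_def by blast
qed

section \<open>Parents in a naturally oriented tree\<close>

lemma path_closes_to_cycle:
  fixes H :: "'v pair_pre_digraph"
  assumes wf: "pair_wf_digraph H"
    and apath: "pre_digraph.apath (with_proj H) x p x'" and ne: "x \<noteq> x'"
    and y: "y \<notin> set (pre_digraph.awalk_verts (with_proj H) x p)"
    and arcs: "(y, x) \<in> parcs H" "(x', y) \<in> parcs H"
  shows "pre_digraph.cycle (with_proj H) ((y, x) # p @ [(x', y)])"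
    "3 \<le> length ((y, x) # p @ [(x', y)])"
proof -
  interpret pair_wf_digraph H by (rule wf)
  have "awalk x p x'" "distinct (awalk_verts x p)" "p \<noteq> []"
    using apath ne by (auto simp: apath_def awalk_Nil_iff)
  have yH: "y \<in> pverts H" using arcs(1) in_arcsD1 by blast
  show "3 \<le> length ((y, x) # p @ [(x', y)])" using \<open>p \<noteq> []\<close> by (cases p) auto
  have w: "awalk y ((y, x) # p @ [(x', y)]) y"
    using \<open>awalk x p x'\<close> arcs yH by (auto simp: awalk_simps)
  have "awalk x (p @ [(x', y)]) y" using \<open>awalk x p x'\<close> arcs yH by (auto simp: awalk_simps)
  then have "awalk_verts x (p @ [(x', y)]) = awalk_verts x p @ [y]"
    using arcs by (simp add: awalk_verts_append[of x p "[(x', y)]" y])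
  then have "distinct (tl (awalk_verts y ((y, x) # p @ [(x', y)])))"
    using y \<open>distinct (awalk_verts x p)\<close> by simp
  then show "cycle ((y, x) # p @ [(x', y)])"
    using w unfolding cycle_def by blast
qed

context weighted_naturally_oriented_tree
begin

lemma parcs_underlying:
  "parcs (mk_symmetric (with_proj D)) = parcs D \<union> (parcs D)\<inverse>"
  by (auto simp: parcs_mk_symmetric)

text \<open>
  A walk from the root to \<open>x\<close> that is shorter than the distance to \<open>y\<close> cannot meet
  \<open>y\<close>.
\<close>

lemma walk_from_root_avoiding_head:
  assumes "(x, y) \<in> parcs D"
  shows "\<exists>p. pre_digraph.awalk (underlying_graph D) x0 p x \<and>
    y \<notin> set (pre_digraph.awalk_verts (underlying_graph D) x0 p)"
proof -
  interpret U: pair_wf_digraph "mk_symmetric (with_proj D)" ..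
  have "underlying_dist D x0 x < underlying_dist D x0 y" using assms by (rule oriented_away)
  then obtain p where p: "U.awalk x0 p x" "awalk_cost (\<lambda>_. 1) p < U.\<mu> (\<lambda>_. 1) x0 y"
    unfolding underlying_dist_def underlying_graph_def U.\<mu>_def by (auto simp: INF_less_iff)
  have "y \<notin> set (U.awalk_verts x0 p)"
  proof
    assume "y \<in> set (U.awalk_verts x0 p)"
    then obtain q s where "p = q @ s" "U.awalk x0 q y"
      using U.awalk_decomp[OF p(1)] by blast
    then have "U.\<mu> (\<lambda>_. 1) x0 y \<le> U.awalk_cost (\<lambda>_. 1) q"
      "U.awalk_cost (\<lambda>_. 1) q \<le> U.awalk_cost (\<lambda>_. 1) p"
      using U.min_cost_le_walk_cost[of x0 q y "\<lambda>_. 1"] by (simp_all add: awalk_cost_def sum_list_triv)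
    then show False using p(2) by (meson ereal_less_eq(3) leD order_trans)
  qed
  then show ?thesis using p(1) unfolding underlying_graph_def by auto
qed

text \<open>
  If \<open>y\<close> had two parents, both would be connected to the root in the graph without
  \<open>y\<close>, hence to each other by a path, and the two edges at \<open>y\<close> would close this path
  to a cycle of length at least three.
\<close>

lemma unique_parent:
  assumes "(x, y) \<in> parcs D" "(x', y) \<in> parcs D"
  shows "x = x'"
proof (rule ccontr)
  assume "x \<noteq> x'"
  let ?U = "mk_symmetric (with_proj D)"
  define H where "H = \<lparr>pverts = pverts D - {y},
    parcs = {(u, v) \<in> parcs ?U. u \<noteq> y \<and> v \<noteq> y}\<rparr>"
  interpret U: pair_wf_digraph ?U ..
  interpret H: pair_wf_digraph H
    using U.in_arcsD1 U.in_arcsD2 by unfold_locales (auto simp: H_def)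
  have sym: "symmetric (with_proj H)"
    unfolding symmetric_def by (auto simp: H_def parcs_underlying intro!: symI)
  have sub: "subgraph (with_proj H) (with_proj ?U)"
    using U.wf_digraph_axioms H.wf_digraph_axioms
    by (intro subgraphI) (simp_all add: H_def compatible_def subset_iff)
  have reach: "x0 \<rightarrow>\<^sup>*\<^bsub>with_proj H\<^esub> z" if zy: "(z, y) \<in> parcs D" for z
  proof -
    obtain p where p: "U.awalk x0 p z" "y \<notin> set (U.awalk_verts x0 p)"
      using walk_from_root_avoiding_head[OF zy] unfolding underlying_graph_def by auto
    have "set (U.awalk_verts x0 p) = {x0} \<union> fst ` set p \<union> snd ` set p"
      using U.set_awalk_verts[OF p(1)] by simp
    then have ny: "y \<noteq> x0" "y \<notin> fst ` set p" "y \<notin> snd ` set p"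
      using p(2) by simp_all
    have walk: "set p \<subseteq> parcs ?U" "pcas x0 p z"
      using p(1) unfolding U.awalk_def by simp_all
    have "set p \<subseteq> parcs H"
    proof
      fix e assume "e \<in> set p"
      then have "e \<in> parcs ?U" "fst e \<noteq> y" "snd e \<noteq> y" using ny walk by blast+
      then show "e \<in> parcs H" unfolding H_def by (simp add: split_def)
    qed
    moreover have "x0 \<in> pverts H" using root ny unfolding H_def by simp
    ultimately have "H.awalk x0 p z" using walk(2) unfolding H.awalk_def by simp
    then show ?thesis by (rule H.reachable_awalkI)
  qed
  have "x \<rightarrow>\<^sup>*\<^bsub>with_proj H\<^esub> x'"
    by (rule H.reachable_trans[OF symmetric_reachable[OF sym reach[OF assms(1)]] reach[OF assms(2)]])
  then obtain p where p: "H.apath x p x'" unfolding H.reachable_apath by blast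
  then have "H.awalk x p x'" by (rule H.awalkI_apath)
  then have "set (U.awalk_verts x p) \<subseteq> pverts H" using H.awalk_verts_in_verts by blast
  then have "y \<notin> set (U.awalk_verts x p)" unfolding H_def by auto
  moreover have "U.apath x p x'" using p sub by (rule U.subgraph_apath_imp_apath)
  moreover have "(y, x) \<in> parcs ?U" "(x', y) \<in> parcs ?U"
    using assms unfolding parcs_underlying by simp_all
  ultimately show False
    using path_closes_to_cycle[OF U.pair_wf_digraph_axioms _ \<open>x \<noteq> x'\<close>, of p y]
      tree unfolding underlying_tree_def underlying_graph_def by auto
qed

end

section \<open>The edge ideal of a naturally oriented tree\<close>

lemma exists_linear_order_refining_rank:
  fixes rank :: "'a \<Rightarrow> 'b::linorder"
  assumes "finite G"
  shows "\<exists>r. linear_order_on G r \<and> (\<forall>a b. (a, b) \<in> r \<longrightarrow> rank a \<le> rank b)"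
proof -
  obtain f :: "'a \<Rightarrow> nat" where f: "inj_on f G"
    using finite_imp_inj_to_nat_seg[OF assms] by blast
  define r where "r = {(a, b). a \<in> G \<and> b \<in> G \<and>
    (rank a < rank b \<or> rank a = rank b \<and> f a \<le> f b)}"
  have "refl_on G r" "trans r" "total_on G r"
    unfolding refl_on_def trans_def total_on_def r_def by auto
  moreover have "antisym r"
    unfolding r_def using f by (auto intro!: antisymI dest: inj_onD)
  moreover have "r \<subseteq> G \<times> G" by (auto simp: r_def)
  ultimately have "linear_order_on G r"
    by (simp add: linear_order_on_def partial_order_on_def preorder_on_def)
  moreover have "\<forall>a b. (a, b) \<in> r \<longrightarrow> rank a \<le> rank b" by (auto simp: r_def)
  ultimately show ?thesis by blast
qed

definition edge_monomial :: "('v \<Rightarrow> nat) \<Rightarrow> 'v \<times> 'v \<Rightarrow> 'v multiset" where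
  "edge_monomial w e = {#fst e#} + replicate_mset (w (snd e)) (snd e)"

context weighted_naturally_oriented_tree
begin

lemma arc_ends:
  assumes "(p, c) \<in> parcs D"
  shows "p \<noteq> c" "(c, p) \<notin> parcs D" "p \<in> pverts D" "c \<in> pverts D" "0 < w c"
  using assms no_loops no_antiparallel_arcs weight_pos in_arcsD1 in_arcsD2 by fastforce+

lemma count_edge_monomial:
  assumes "(p, c) \<in> parcs D"
  shows "count (edge_monomial w (p, c)) x = (if x = p then 1 else if x = c then w c else 0)"
  using arc_ends(1)[OF assms] by (auto simp: edge_monomial_def)

lemma set_edge_monomial:
  assumes "(p, c) \<in> parcs D"
  shows "set_mset (edge_monomial w (p, c)) = {p, c}"
  using arc_ends(5)[OF assms] by (auto simp: edge_monomial_def)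

lemma edge_monomial_antichain:
  assumes "e \<in> parcs D" "e' \<in> parcs D" "edge_monomial w e \<subseteq># edge_monomial w e'"
  shows "e = e'"
proof -
  obtain p c p' c' where e: "e = (p, c)" "e' = (p', c')" by (metis surj_pair)
  have "{p, c} \<subseteq> {p', c'}"
    using set_mset_mono[OF assms(3)] assms(1,2) unfolding e by (simp add: set_edge_monomial)
  then show ?thesis
    using arc_ends(1,2)[of p c] arc_ends(1,2)[of p' c'] assms(1,2) unfolding e by auto
qed

lemma inj_edge_monomial: "inj_on (edge_monomial w) (parcs D)"
  using edge_monomial_antichain by (auto intro!: inj_onI)

text \<open>
  The arcs that can reach the exponent of the head \<open>y\<close> of \<open>e\<close> in its monomial. Since
  \<open>y\<close> has only one parent, every other arc at \<open>y\<close> starts there and contributes exponent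
  1, which suffices only if the weight of \<open>y\<close> is 1.
\<close>

definition arcs_below :: "'v \<times> 'v \<Rightarrow> ('v \<times> 'v) set" where
  "arcs_below e = {e' \<in> parcs D. fst e' = snd e \<and> w (snd e) = 1}"

definition arcs_at_tail :: "'v \<times> 'v \<Rightarrow> ('v \<times> 'v) set" where
  "arcs_at_tail e = {e' \<in> parcs D. e' \<noteq> e \<and> (snd e' = fst e \<or> fst e' = fst e)}"

lemma edge_bridge_iff:
  assumes S: "S \<subseteq> parcs D" and e: "e \<in> parcs D"
  shows "is_bridge (edge_monomial w e) (edge_monomial w ` S) \<longleftrightarrow>
    e \<in> S \<and> arcs_below e \<inter> S \<noteq> {} \<and> arcs_at_tail e \<inter> S \<noteq> {}"
proof -
  let ?m = "edge_monomial w"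
  obtain p c where pc: "e = (p, c)" by force
  have e': "(p, c) \<in> parcs D" using e pc by simp
  have fin: "finite (?m ` S)" using S finite_arcs finite_subset by blast
  have mem: "?m e \<in> ?m ` S \<longleftrightarrow> e \<in> S"
    using inj_on_image_mem_iff[OF inj_edge_monomial e S] .
  have minus: "?m ` S - {?m e} = ?m ` (S - {e})"
    using inj_edge_monomial S e by (auto dest: inj_onD)
  have "is_bridge (?m e) (?m ` S) \<longleftrightarrow>
      e \<in> S \<and> (\<forall>x \<in># ?m e. \<exists>e' \<in> S - {e}. count (?m e) x \<le> count (?m e') x)"
    by (subst is_bridge_iff[OF fin]) (simp add: mem minus)
  also have "\<dots> \<longleftrightarrow> e \<in> S \<and> (\<exists>e' \<in> S - {e}. count (?m e) p \<le> count (?m e') p) \<and>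
      (\<exists>e' \<in> S - {e}. count (?m e) c \<le> count (?m e') c)"
    using set_edge_monomial[OF e'] pc by simp
  also have "(\<exists>e' \<in> S - {e}. count (?m e) p \<le> count (?m e') p) \<longleftrightarrow> arcs_at_tail e \<inter> S \<noteq> {}"
  proof -
    have "count (?m e) p \<le> count (?m (p', c')) p \<longleftrightarrow> c' = p \<or> p' = p"
      if "(p', c') \<in> parcs D" for p' c'
      using count_edge_monomial[OF e', of p] count_edge_monomial[OF that, of p] arc_ends(5)[OF that]
      by (auto simp: pc)
    then have "e' \<in> arcs_at_tail e \<longleftrightarrow> e' \<noteq> e \<and> count (?m e) p \<le> count (?m e') p"
      if "e' \<in> S" for e'
      using that S by (cases e') (auto simp: arcs_at_tail_def pc)
    then show ?thesis by blast
  qed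
  also have "(\<exists>e' \<in> S - {e}. count (?m e) c \<le> count (?m e') c) \<longleftrightarrow> arcs_below e \<inter> S \<noteq> {}"
  proof -
    have "count (?m e) c \<le> count (?m (p', c')) c \<longleftrightarrow> p' = c \<and> w c = 1"
      if "(p', c') \<in> parcs D" "(p', c') \<noteq> e" for p' c'
    proof -
      have "c' \<noteq> c" using unique_parent[OF e'] that pc by blast
      then show ?thesis
        using count_edge_monomial[OF e', of c] count_edge_monomial[OF that(1), of c]
          arc_ends(1,5)[OF e'] by (auto simp: pc)
    qed
    moreover have "e \<notin> arcs_below e" using arc_ends(1)[OF e'] by (auto simp: arcs_below_def pc)
    ultimately have "e' \<in> arcs_below e \<longleftrightarrow> e' \<noteq> e \<and> count (?m e) c \<le> count (?m e') c"
      if "e' \<in> S" for e'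
      using that S by (cases e') (auto simp: arcs_below_def pc)
    then show ?thesis by blast
  qed
  finally show ?thesis by blast
qed

text \<open>
  If \<open>e'\<close> is the arc into the tail of \<open>e\<close>, the arcs below it are among
  \<open>e\<close> and its siblings. If \<open>e'\<close> is a sibling of \<open>e\<close>, both have the same tail.
\<close>

lemma arcs_at_tail_exchange:
  assumes e': "e' \<in> arcs_at_tail e"
  shows "arcs_below e' \<subseteq> insert e (arcs_at_tail e) \<or> arcs_at_tail e' \<subseteq> insert e (arcs_at_tail e)"
  using e' unfolding arcs_at_tail_def arcs_below_def by auto

text \<open>
  The order sorts the generators by decreasing distance of the head from the root. Any
  order in which child arcs precede their parent arc would serve; ties are broken arbitrarily.
\<close>

lemma local_bridges_edge_monomials:
  "\<exists>r lower upper. local_bridges (edge_monomial w ` parcs D) r lower upper"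
proof -
  let ?m = "edge_monomial w"
  let ?G = "?m ` parcs D"
  define arc where "arc = the_inv_into (parcs D) ?m"
  have arc: "arc (?m e) = e" if "e \<in> parcs D" for e
    using that inj_edge_monomial by (simp add: arc_def the_inv_into_f_f)
  have fin: "finite ?G" using finite_arcs by simp
  from exists_linear_order_refining_rank[OF this, of "\<lambda>m. - underlying_dist D x0 (snd (arc m))"]
  obtain r where lin: "linear_order_on ?G r"
    and rank: "\<forall>a b. (a, b) \<in> r \<longrightarrow>
      - underlying_dist D x0 (snd (arc a)) \<le> - underlying_dist D x0 (snd (arc b))"
    by (elim exE conjE)
  have "local_bridges ?G r (\<lambda>m. ?m ` arcs_below (arc m)) (\<lambda>m. ?m ` arcs_at_tail (arc m))"
  proof
    show "finite ?G" by (rule fin)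
    show "linear_order_on ?G r" by (rule lin)
  next
    fix \<sigma> m assume "\<sigma> \<subseteq> ?G"
    then obtain S where S: "S \<subseteq> parcs D" "\<sigma> = ?m ` S" by (auto simp: subset_image_iff)
    show "is_bridge m \<sigma> \<longleftrightarrow> m \<in> \<sigma> \<and> ?m ` arcs_below (arc m) \<inter> \<sigma> \<noteq> {} \<and>
      ?m ` arcs_at_tail (arc m) \<inter> \<sigma> \<noteq> {}"
    proof (cases "m \<in> \<sigma>")
      case True
      then obtain e where e: "e \<in> S" "m = ?m e" using S by blast
      have eD: "e \<in> parcs D" using e S by blast
      have img: "?m ` T \<inter> ?m ` S \<noteq> {} \<longleftrightarrow> T \<inter> S \<noteq> {}" if "T \<subseteq> parcs D" for T
        using inj_on_image_Int[OF inj_edge_monomial that S(1)] by (metis image_is_empty)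
      have "arcs_below e \<subseteq> parcs D" "arcs_at_tail e \<subseteq> parcs D"
        by (auto simp: arcs_below_def arcs_at_tail_def)
      then show ?thesis
        using edge_bridge_iff[OF S(1) eD] True e img arc[OF eD] S(2) by simp
    qed (simp add: is_bridge_def)
  next
    fix m c assume "m \<in> ?G" and c: "c \<in> ?m ` arcs_below (arc m)"
    then obtain e where e: "e \<in> parcs D" "m = ?m e" by blast
    obtain e' where e': "e' \<in> parcs D" "fst e' = snd e" "c = ?m e'"
      using c arc[OF e(1)] e(2) by (auto simp: arcs_below_def)
    have "(snd e, snd e') \<in> parcs D" using e' by (metis prod.collapse)
    then have "underlying_dist D x0 (snd e) < underlying_dist D x0 (snd e')" by (rule oriented_away)
    then show "(m, c) \<notin> r"
      using rank[rule_format, of m c] arc[OF e(1)] arc[OF e'(1)] e(2) e'(3) by auto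
  next
    fix m :: "'v multiset"
    show "m \<notin> ?m ` arcs_at_tail (arc m)"
    proof
      assume "m \<in> ?m ` arcs_at_tail (arc m)"
      then obtain e where "e \<in> arcs_at_tail (arc m)" "m = ?m e" by blast
      then show False using arc[of e] by (auto simp: arcs_at_tail_def)
    qed
  next
    fix m c assume "m \<in> ?G" and c: "c \<in> ?m ` arcs_at_tail (arc m)"
    then obtain e where e: "e \<in> parcs D" "m = ?m e" by blast
    obtain e' where e': "e' \<in> arcs_at_tail e" "c = ?m e'"
      using c arc[OF e(1)] e(2) by auto
    then have "arc c = e'" using arc[of e'] by (simp add: arcs_at_tail_def)
    then show "?m ` arcs_below (arc c) \<subseteq> insert m (?m ` arcs_at_tail (arc m)) \<or>
      ?m ` arcs_at_tail (arc c) \<subseteq> insert m (?m ` arcs_at_tail (arc m))"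
      using arcs_at_tail_exchange[OF e'(1)] arc[OF e(1)] e(2)
      by (metis image_insert image_mono)
  qed
  then show ?thesis by blast
qed

end

theorem theorem3p11:
  fixes D :: "'v pair_pre_digraph" and w :: "'v \<Rightarrow> nat" and x0 :: 'v
  assumes "weighted_naturally_oriented_tree D w x0"
  shows "bridge_friendly (pverts D) (edge_ideal D w :: ('v multiset \<Rightarrow>\<^sub>0 'k::field) set)"
proof -
  interpret weighted_naturally_oriented_tree D w x0 by (rule assms)
  let ?G = "edge_monomial w ` parcs D"
  have ideal: "edge_ideal D w = genideal (mpoly_ring (pverts D))
      (mpoly_monom ` ?G :: ('v multiset \<Rightarrow>\<^sub>0 'k) set)"
    unfolding edge_ideal_def
    by (rule arg_cong[of _ _ "genideal _"]) (force simp: edge_monomial_def image_iff)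
  have supp: "\<forall>m \<in> ?G. set_mset m \<subseteq> pverts D"
    using set_edge_monomial arc_ends(3,4) by auto
  have anti: "m = m'" if "m \<in> ?G" "m' \<in> ?G" "m \<subseteq># m'" for m m'
    using that by (elim imageE) (metis edge_monomial_antichain)
  have min: "minimal_monomial_generators (pverts D)
      (edge_ideal D w :: ('v multiset \<Rightarrow>\<^sub>0 'k) set) ?G"
    unfolding ideal by (rule antichain_minimal_monomial_generators[OF supp anti])
  obtain r lower upper where "local_bridges ?G r lower upper"
    using local_bridges_edge_monomials by (elim exE)
  then interpret local_bridges ?G r lower upper .
  show ?thesis
    unfolding bridge_friendly_def
    by (intro exI[of _ ?G] exI[of _ r] conjI allI impI min linear potentially_type2_imp_type2)
qed

end
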